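(* Let $\mathcal{J}:\mathbb{R}^n\to\mathbb{R}\cup\{\infty\}$ be proper, coercive, lower semi-continuous, and continuous on its domain, and let $\operatorname{dom}\mathcal{J}$ be a convex polyhedron. Let $V\subset\mathbb{R}^n$ be a linear subspace, and let $\mathcal{M}^{\mathrm{ex}}:\operatorname{dom}\mathcal{J}\to\operatorname{dom}\mathcal{J}$ be an exact minimization operator, i.e. $\mathcal{M}^{\mathrm{ex}}(w)$ is a (any) global minimizer of $\mathcal{J}$ in $w+V$ for each $w\in\operatorname{dom}\mathcal{J}$. Then $\mathcal{M}=\tilde{\mathcal{M}}=\mathcal{M}^{\mathrm{ex}}$ satisfies: 1. (Monotonicity) $\mathcal{J}(\mathcal{M}(w))\le\mathcal{J}(\tilde{\mathcal{M}}(w))\le\mathcal{J}(w)$ for all $w\in\operatorname{dom}\mathcal{J}$; 2. (Continuity) $\mathcal{J}\circ\tilde{\mathcal{M}}$ is continuous on $\operatorname{dom}\mathcal{J}$; 3. (Stability) $\mathcal{J}(\tilde{\mathcal{M}}(w))<\mathcal{J}(w)$ for every $w\in\operatorname{dom}\mathcal{J}$ such that $\mathcal{J}(w)$ is not minimal in $w+V$.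
   Context: $\operatorname{dom}\mathcal{J}=\{x : \mathcal{J}(x)<\infty\}$, with the topology induced from $\mathbb{R}^n$. Coercive means $\mathcal{J}(v)\to\infty$ as $\|v\|\to\infty$. "Continuous on its domain" means that the restriction of $\mathcal{J}$ to $\operatorname{dom}\mathcal{J}$ is continuous. A convex polyhedron is a (not necessarily closed) set of the form $\{x\in\mathbb{R}^n : \langle b_i,x\rangle\lhd_i c_i,\ i=1,\dots,l\}$, where each $\lhd_i$ is either $<$ or $\le$. *)

theory Defs
  imports "HOL-Analysis.Analysis"
begin

definition edom :: "('a \<Rightarrow> ereal) \<Rightarrow> 'a set" where
  "edom J = {x. J x < \<infinity>}"

definition proper :: "('a \<Rightarrow> ereal) \<Rightarrow> bool" where
  "proper J \<longleftrightarrow> (\<forall>x. J x \<noteq> -\<infinity>) \<and> edom J \<noteq> {}"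

definition coercive :: "('a::real_normed_vector \<Rightarrow> ereal) \<Rightarrow> bool" where
  "coercive J \<longleftrightarrow> (J \<longlongrightarrow> \<infinity>) at_infinity"

(* The limit inferior is taken over punctured neighbourhoods; including the point x itself
   would give the same notion. *)
definition lower_semicontinuous :: "('a::topological_space \<Rightarrow> ereal) \<Rightarrow> bool" where
  "lower_semicontinuous J \<longleftrightarrow> (\<forall>x. J x \<le> Liminf (at x) J)"

(* Unlike the library's polyhedron, strict inequalities are allowed, so the set need not be
   closed; strict i says that the i-th inequality is strict. *)
definition convex_polyhedron :: "'a::euclidean_space set \<Rightarrow> bool" where
  "convex_polyhedron P \<longleftrightarrow>
     (\<exists>(l::nat) (b::nat \<Rightarrow> 'a) (c::nat \<Rightarrow> real) (strict::nat \<Rightarrow> bool).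
        P = {x. \<forall>i<l. if strict i then b i \<bullet> x < c i else b i \<bullet> x \<le> c i})"

definition minimizer_in_coset :: "('a::real_vector \<Rightarrow> ereal) \<Rightarrow> 'a set \<Rightarrow> 'a \<Rightarrow> 'a \<Rightarrow> bool" where
  "minimizer_in_coset J V w x \<longleftrightarrow> is_arg_min J (\<lambda>y. y \<in> (+) w ` V) x"

(* An operator on edom J is a total function here; its values outside edom J are irrelevant. *)
definition exact_minimization_operator ::
    "('a::real_vector \<Rightarrow> ereal) \<Rightarrow> 'a set \<Rightarrow> ('a \<Rightarrow> 'a) \<Rightarrow> bool" where
  "exact_minimization_operator J V M \<longleftrightarrow>
     M \<in> edom J \<rightarrow> edom J \<and> (\<forall>w\<in>edom J. minimizer_in_coset J V w (M w))"

end

theory Submission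
  imports Defs
begin

text \<open>
  Only the continuity of the value function \<open>w \<mapsto> min J (w + V)\<close> needs an argument.

  Lower semicontinuity: the sublevel sets \<open>K\<close> of \<open>J\<close> are compact, so \<open>K + V\<close>, the set of points
  at which the value function is at most the level, is closed.

  Upper semicontinuity: a polyhedron is locally conical, so a point \<open>x\<close> of the domain near \<open>w\<close>
  lies on a segment from \<open>w\<close> to a point \<open>z\<close> of the domain at a fixed distance \<open>r\<close> from \<open>w\<close>.
  Replacing the endpoint \<open>w\<close> by a minimizer \<open>y\<close> in \<open>w + V\<close> and keeping the same ratio gives a point
  of the domain in \<open>x + V\<close> that tends to \<open>y\<close> as \<open>x\<close> tends to \<open>w\<close>, and \<open>J\<close> is continuous there.
\<close>

lemma closed_sublevel_if_lower_semicontinuous: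
  fixes J :: "'a::topological_space \<Rightarrow> ereal"
  assumes "lower_semicontinuous J"
  shows "closed {x. J x \<le> a}"
proof -
  have "\<exists>T. open T \<and> x \<in> T \<and> T \<subseteq> {x. a < J x}" if "a < J x" for x
  proof -
    have "a < Liminf (at x) J"
      using assms that unfolding lower_semicontinuous_def by (meson less_le_trans)
    then have "\<forall>\<^sub>F y in at x. a < J y"
      by (rule less_LiminfD)
    then obtain T where "open T" "x \<in> T" "\<And>y. y \<in> T \<Longrightarrow> y \<noteq> x \<Longrightarrow> a < J y"
      unfolding eventually_at_topological by auto
    \<comment> \<open>\<open>T\<close> comes from a punctured neighbourhood, so the point
      \<open>x\<close> itself is covered by the assumption \<open>a < J x\<close>.\<close>
    then show ?thesis
      using that by (intro exI[of _ T]) auto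
  qed
  then have "open {x. a < J x}"
    using open_subopen[of "{x. a < J x}"] by simp
  moreover have "- {x. J x \<le> a} = {x. a < J x}"
    by auto
  ultimately show ?thesis
    by (simp add: closed_def)
qed

lemma bounded_sublevel_if_coercive:
  fixes J :: "'a::real_normed_vector \<Rightarrow> ereal"
  assumes "coercive J" "a < \<infinity>"
  shows "bounded {x. J x \<le> a}"
proof -
  have "\<forall>\<^sub>F x in at_infinity. a < J x"
    using assms by (simp add: coercive_def order_tendstoD(1))
  then obtain B where "\<And>x. B \<le> norm x \<Longrightarrow> a < J x"
    unfolding eventually_at_infinity by blast
  then show ?thesis
    by (intro boundedI[where B = B]) (metis leD linear mem_Collect_eq)
qed

lemma convex_convex_polyhedron:
  assumes "convex_polyhedron P"
  shows "convex P"
proof -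
  obtain l :: nat and b c strict where
    P: "P = {x. \<forall>i<l. if strict i then b i \<bullet> x < c i else b i \<bullet> x \<le> c i}"
    using assms unfolding convex_polyhedron_def by blast
  have "P = (\<Inter>i\<in>{..<l}. if strict i then {x. b i \<bullet> x < c i} else {x. b i \<bullet> x \<le> c i})"
    unfolding P by (auto split: if_splits)
  moreover have "convex \<dots>"
    by (rule convex_INT) (simp add: convex_halfspace_le convex_halfspace_lt)
  ultimately show ?thesis
    by simp
qed

text \<open>Inequalities strict at \<open>w\<close> stay strict on a small ball. Those tight at
  \<open>w\<close> give \<open>b i \<bullet> (x - w) \<le> 0\<close>, which survives scaling by any
  \<open>t \<ge> 0\<close>, including \<open>t > 1\<close>.\<close>

lemma convex_polyhedron_locally_conical:
  fixes P :: "'a::euclidean_space set"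
  assumes "convex_polyhedron P" "w \<in> P"
  obtains r where "r > 0"
    "\<And>x t. x \<in> P \<Longrightarrow> t \<ge> 0 \<Longrightarrow> t * norm (x - w) \<le> r \<Longrightarrow> w + t *\<^sub>R (x - w) \<in> P"
proof -
  obtain l :: nat and b c strict where
    P: "P = {x. \<forall>i<l. if strict i then b i \<bullet> x < c i else b i \<bullet> x \<le> c i}"
    using assms unfolding convex_polyhedron_def by blast
  define A where "A = {i. i < l \<and> b i \<bullet> w < c i}"
  have "open (\<Inter>i\<in>A. {x. b i \<bullet> x < c i})"
    by (intro open_INT) (auto simp: A_def open_halfspace_lt)
  moreover have "w \<in> (\<Inter>i\<in>A. {x. b i \<bullet> x < c i})"
    by (auto simp: A_def)
  ultimately obtain r where r: "r > 0" "cball w r \<subseteq> (\<Inter>i\<in>A. {x. b i \<bullet> x < c i})"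
    by (meson open_contains_cball)
  show thesis
  proof (rule that[OF r(1)])
    fix x t assume x: "x \<in> P" and t: "t \<ge> 0" "t * norm (x - w) \<le> r"
    define z where "z = w + t *\<^sub>R (x - w)"
    have "z \<in> cball w r"
      using t by (simp add: z_def dist_norm)
    then have inactive: "b i \<bullet> z < c i" if "i \<in> A" for i
      using r(2) that by blast
    have "if strict i then b i \<bullet> z < c i else b i \<bullet> z \<le> c i" if i: "i < l" for i
    proof (cases "i \<in> A")
      case True
      then show ?thesis
        using inactive[of i] by auto
    next
      case False
      have "if strict i then b i \<bullet> w < c i else b i \<bullet> w \<le> c i"
        using assms(2) i unfolding P by blast
      \<comment> \<open>A strict inequality cannot be tight at \<open>w\<close>, since
        \<open>w\<close> lies in \<open>P\<close>.\<close>
      then have active: "\<not> strict i" "b i \<bullet> w = c i"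
        using False i by (auto simp: A_def split: if_splits)
      have "b i \<bullet> x \<le> c i"
        using x i active(1) unfolding P by auto
      then have "t * (b i \<bullet> x - b i \<bullet> w) \<le> 0"
        using t(1) active(2) by (simp add: mult_nonneg_nonpos)
      then show ?thesis
        using active by (simp add: z_def inner_add_right inner_diff_right)
    qed
    then show "w + t *\<^sub>R (x - w) \<in> P"
      unfolding P z_def by blast
  qed
qed

text \<open>The translate \<open>y + (x - w)\<close> may leave \<open>P\<close>; the correction
  along \<open>y - w\<close> brings it back. With \<open>s = dist x w / r\<close>, the corrected
  point is the convex combination \<open>(1 - s) y + s z\<close>, where
  \<open>z = w + (x - w) / s\<close>.\<close>

lemma convex_polyhedron_transport:
  fixes P :: "'a::euclidean_space set"
  assumes P: "convex_polyhedron P" and "w \<in> P" "y \<in> P"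
  obtains r where "r > 0"
    "\<And>x. x \<in> P \<Longrightarrow> dist x w \<le> r \<Longrightarrow> y + (x - w) - (dist x w / r) *\<^sub>R (y - w) \<in> P"
proof -
  obtain r where r: "r > 0"
    "\<And>x t. x \<in> P \<Longrightarrow> t \<ge> 0 \<Longrightarrow> t * norm (x - w) \<le> r \<Longrightarrow> w + t *\<^sub>R (x - w) \<in> P"
    using convex_polyhedron_locally_conical[OF P \<open>w \<in> P\<close>] by blast
  show thesis
  proof (rule that[OF r(1)])
    fix x assume x: "x \<in> P" "dist x w \<le> r"
    define s where "s = dist x w / r"
    show "y + (x - w) - s *\<^sub>R (y - w) \<in> P"
    \<comment> \<open>For \<open>x = w\<close> the ratio \<open>s\<close> vanishes and
      \<open>z\<close> is undefined, but the point is then \<open>y\<close> itself.\<close>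
    proof (cases "x = w")
      case True
      then show ?thesis
        using \<open>y \<in> P\<close> by (simp add: s_def)
    next
      case False
      have s: "0 < s" "s \<le> 1"
        using False r(1) x(2) by (auto simp: s_def)
      \<comment> \<open>This point has distance exactly \<open>r\<close> from \<open>w\<close>, the
        largest stretch that \<open>r(2)\<close> allows.\<close>
      have "w + (1 / s) *\<^sub>R (x - w) \<in> P"
        using r x False s by (intro r(2)) (auto simp: s_def dist_norm)
      then have "(1 - s) *\<^sub>R y + s *\<^sub>R (w + (1 / s) *\<^sub>R (x - w)) \<in> P"
        using convex_convex_polyhedron[OF P] \<open>y \<in> P\<close> s by (simp add: convex_alt)
      moreover have "(1 - s) *\<^sub>R y + s *\<^sub>R (w + (1 / s) *\<^sub>R (x - w)) = y + (x - w) - s *\<^sub>R (y - w)"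
        using s(1) by (simp add: algebra_simps)
      ultimately show ?thesis
        by simp
    qed
  qed
qed

lemma exact_minimization_operatorD:
  assumes "exact_minimization_operator J V M" "w \<in> edom J"
  shows "M w \<in> edom J" "M w - w \<in> V" "\<And>y. y - w \<in> V \<Longrightarrow> J (M w) \<le> J y"
proof -
  have "minimizer_in_coset J V w (M w)" and dom: "M w \<in> edom J"
    using assms unfolding exact_minimization_operator_def by auto
  then have arg: "M w \<in> (+) w ` V" "\<And>y. y \<in> (+) w ` V \<Longrightarrow> \<not> J y < J (M w)"
    unfolding minimizer_in_coset_def is_arg_min_def by auto
  show "M w \<in> edom J" by (fact dom)
  show "M w - w \<in> V" using arg(1) by auto
  show "J (M w) \<le> J y" if "y - w \<in> V" for y
  proof -
    have "y \<in> (+) w ` V"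
      using that by (intro image_eqI[where x = "y - w"]) auto
    then show ?thesis
      using arg(2) by (simp add: not_less)
  qed
qed

lemma eventually_value_greater:
  fixes J :: "'a::euclidean_space \<Rightarrow> ereal"
  assumes "coercive J" "lower_semicontinuous J" "subspace V"
    and M: "exact_minimization_operator J V M"
    and w: "w \<in> edom J" and a: "a < J (M w)"
  shows "\<forall>\<^sub>F x in at w within edom J. a < J (M x)"
proof -
  define K where "K = {x. J x \<le> a}"
  define S where "S = (\<Union>k\<in>K. \<Union>v\<in>V. {k + v})"
  have "a < \<infinity>"
    using a by auto
  \<comment> \<open>Coercivity bounds sublevel sets at levels below infinity only, hence the
    preceding bound on \<open>a\<close>.\<close>
  then have "compact K"
    unfolding K_def using assms(1,2)
    by (simp add: compact_eq_bounded_closed bounded_sublevel_if_coercive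
        closed_sublevel_if_lower_semicontinuous)
  then have "closed S"
    unfolding S_def using \<open>subspace V\<close> by (intro compact_closed_sums closed_subspace)
  moreover have "w \<notin> S"
  proof
    assume "w \<in> S"
    then obtain k v where "k \<in> K" "v \<in> V" "w = k + v"
      by (auto simp: S_def)
    then have "J (M w) \<le> J k"
      using exact_minimization_operatorD(3)[OF M w, of k] \<open>subspace V\<close>
      by (simp add: subspace_neg)
    then show False
      using \<open>k \<in> K\<close> a by (auto simp: K_def)
  qed
  ultimately have "\<forall>\<^sub>F x in nhds w. x \<notin> S"
    using eventually_nhds_in_open[of "- S" w] by (simp add: open_Compl)
  then have "\<forall>\<^sub>F x in at w within edom J. x \<notin> S \<and> x \<in> edom J"
    by (auto simp: eventually_at_filter elim: eventually_mono)
  then show ?thesis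
  proof (rule eventually_mono)
    fix x assume x: "x \<notin> S \<and> x \<in> edom J"
    have "x - M x \<in> V"
      using subspace_neg[OF \<open>subspace V\<close> exact_minimization_operatorD(2)[OF M]] x by simp
    \<comment> \<open>The sum is \<open>x\<close>, which lies outside \<open>S\<close>.\<close>
    then have "M x + (x - M x) \<in> S" if "M x \<in> K"
      unfolding S_def using that by blast
    then have "M x \<notin> K"
      using x by auto
    then show "a < J (M x)"
      by (simp add: K_def)
  qed
qed

text \<open>One competitor in each coset \<open>x + V\<close> suffices: the transported minimizer
  stays in the domain, so continuity of \<open>J\<close> relative to the domain applies along
  it.\<close>

lemma eventually_value_less:
  fixes J :: "'a::euclidean_space \<Rightarrow> ereal"
  assumes cont: "continuous_on (edom J) J" and P: "convex_polyhedron (edom J)" and "subspace V"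
    and M: "exact_minimization_operator J V M"
    and w: "w \<in> edom J" and a: "J (M w) < a"
  shows "\<forall>\<^sub>F x in at w within edom J. J (M x) < a"
proof -
  define y where "y = M w"
  have y: "y \<in> edom J" "y - w \<in> V"
    unfolding y_def using exact_minimization_operatorD(1,2)[OF M w] by this+
  obtain r where r: "r > 0" "\<And>x. x \<in> edom J \<Longrightarrow> dist x w \<le> r \<Longrightarrow>
      y + (x - w) - (dist x w / r) *\<^sub>R (y - w) \<in> edom J"
    using convex_polyhedron_transport[OF P w y(1)] by blast
  define f where "f x = y + (x - w) - (dist x w / r) *\<^sub>R (y - w)" for x
  have "(f \<longlongrightarrow> y + (w - w) - (dist w w / r) *\<^sub>R (y - w)) (at w within edom J)"
    unfolding f_def using r(1) by (intro tendsto_intros) auto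
  then have lim: "(f \<longlongrightarrow> y) (at w within edom J)"
    by simp
  have near: "\<forall>\<^sub>F x in at w within edom J. x \<in> edom J \<and> dist x w \<le> r"
    using r(1) by (auto simp: eventually_at intro!: exI[of _ r])
  then have "\<forall>\<^sub>F x in at w within edom J. f x \<in> edom J"
    by (rule eventually_mono) (use r(2) in \<open>auto simp: f_def\<close>)
  then have "((\<lambda>x. J (f x)) \<longlongrightarrow> J y) (at w within edom J)"
    by (rule continuous_on_tendsto_compose[OF cont lim y(1)])
  then have "\<forall>\<^sub>F x in at w within edom J. J (f x) < a"
    using a by (intro order_tendstoD(2)) (simp add: y_def)
  with near show ?thesis
  proof eventually_elim
    case (elim x)
    \<comment> \<open>Both the translation and the correction differ from \<open>x\<close> by
      multiples of \<open>y - w\<close>, a vector of \<open>V\<close>, so \<open>f x\<close> is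
      admissible in the coset of \<open>x\<close>.\<close>
    have "f x - x = (1 - dist x w / r) *\<^sub>R (y - w)"
      by (simp add: f_def algebra_simps)
    then have "f x - x \<in> V"
      using y(2) \<open>subspace V\<close> by (simp add: subspace_scale)
    then have "J (M x) \<le> J (f x)"
      using exact_minimization_operatorD(3)[OF M] elim by blast
    then show ?case
      using elim by order
  qed
qed

theorem lemma5p2:
  fixes J :: "real ^ 'n \<Rightarrow> ereal"
    and V :: "(real ^ 'n) set"
    and M Mt Mex :: "real ^ 'n \<Rightarrow> real ^ 'n"
  assumes "proper J"
    and "coercive J"
    and "lower_semicontinuous J"
    and "continuous_on (edom J) J"
    and "convex_polyhedron (edom J)"
    and "subspace V"
    and "exact_minimization_operator J V Mex"
    and "\<forall>w\<in>edom J. M w = Mt w \<and> Mt w = Mex w"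
  shows "(\<forall>w\<in>edom J. J (M w) \<le> J (Mt w) \<and> J (Mt w) \<le> J w)
    \<and> continuous_on (edom J) (J \<circ> Mt)
    \<and> (\<forall>w\<in>edom J. \<not> minimizer_in_coset J V w w \<longrightarrow> J (Mt w) < J w)"
proof (intro conjI ballI impI)
  note minimal = exact_minimization_operatorD(3)[OF assms(7)]
  fix w assume w: "w \<in> edom J"
  show "J (M w) \<le> J (Mt w)"
    using assms(8) w by simp
  show "J (Mt w) \<le> J w"
    using minimal[OF w, of w] assms(6,8) w by (simp add: subspace_0)
  assume "\<not> minimizer_in_coset J V w w"
  moreover have "w \<in> (+) w ` V"
    using assms(6) by (intro image_eqI[where x = 0]) (auto simp: subspace_0)
  ultimately obtain v where "v \<in> V" "J (w + v) < J w"
    by (auto simp: minimizer_in_coset_def is_arg_min_def)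
  moreover have "J (Mex w) \<le> J (w + v)"
    using minimal[OF w, of "w + v"] \<open>v \<in> V\<close> by simp
  ultimately show "J (Mt w) < J w"
    using assms(8) w by auto
next
  \<comment> \<open>In the order topology of \<open>ereal\<close>, the two one-sided estimates
    together give the limit.\<close>
  have "continuous_on (edom J) (\<lambda>w. J (Mex w))"
    unfolding continuous_on_def
    using assms(2-7) by (auto intro!: order_tendstoI eventually_value_greater eventually_value_less)
  then show "continuous_on (edom J) (J \<circ> Mt)"
    using assms(8) by (simp add: o_def cong: continuous_on_cong)
qed

end
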